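(* For given $T>0$, let $f$ be a twice differentiable extremal equity strategy on $[0,T]$ with Lagrange multiplier $\nu$. Then $f$ satisfies $$A f''_s+C f_s+D=0\qquad(0\le s\le T),$$ where $$A=1-2\nu,\qquad C=2\nu\left(\alpha-\frac{\sigma_x}{\sigma_S}\right)^2-\alpha^2,\qquad D=\alpha^2\frac{\bar x}{\sigma_S}.$$
   Context: Parameters: $\alpha,\bar x,x_0\in\mathbb{R}$ and $\sigma_x,\sigma_S>0$. Let $\xi_s=\frac1{\sigma_S}\left(\bar x+e^{-\alpha s}(x_0-\bar x)\right)$. An equity strategy is a continuous deterministic function $f:[0,T]\to\mathbb{R}$. Its mean and variance functionals are $$\mu_T[f]=\int_0^T\left(\xi_sf_s-\tfrac12 f_s^2\right)ds,\qquad \sigma_T^2[f]=\int_0^T\left[f_u-\frac{\sigma_x}{\sigma_S}\int_u^T f_se^{-\alpha(s-u)}ds\right]^2du .$$ An extremal equity strategy is a stationary point of the problem of extremizing $\mu_T[f]$ for a given value of $\sigma_T^2[f]$; that is, there is a real number $\nu$ (the Lagrange multiplier) such that for every continuous $\eta:[0,T]\to\mathbb{R}$, $\frac{d}{d\epsilon}\big|_{\epsilon=0}\left(\mu_T[f+\epsilon\eta]+\nu\,\sigma_T^2[f+\epsilon\eta]\right)=0$. *)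

theory Defs
  imports "HOL-Analysis.Analysis"
begin

text \<open>Strategies are total functions on the reals; only their values on \<open>{0..T}\<close> matter.
  All integrals below have continuous integrands whenever the strategy is continuous.\<close>

definition equity_strategy :: "real \<Rightarrow> (real \<Rightarrow> real) \<Rightarrow> bool" where
  "equity_strategy T f \<longleftrightarrow> continuous_on {0..T} f"

definition xi :: "real \<Rightarrow> real \<Rightarrow> real \<Rightarrow> real \<Rightarrow> real \<Rightarrow> real" where
  "xi \<alpha> xbar x0 \<sigma>S s = (1 / \<sigma>S) * (xbar + exp (- \<alpha> * s) * (x0 - xbar))"

definition mean_functional ::
  "real \<Rightarrow> real \<Rightarrow> real \<Rightarrow> real \<Rightarrow> real \<Rightarrow> (real \<Rightarrow> real) \<Rightarrow> real" where
  "mean_functional \<alpha> xbar x0 \<sigma>S T f =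
     integral {0..T} (\<lambda>s. xi \<alpha> xbar x0 \<sigma>S s * f s - (1 / 2) * (f s)\<^sup>2)"

definition variance_functional ::
  "real \<Rightarrow> real \<Rightarrow> real \<Rightarrow> real \<Rightarrow> (real \<Rightarrow> real) \<Rightarrow> real" where
  "variance_functional \<alpha> \<sigma>x \<sigma>S T f =
     integral {0..T} (\<lambda>u.
       (f u - (\<sigma>x / \<sigma>S) * integral {u..T} (\<lambda>s. f s * exp (- \<alpha> * (s - u))))\<^sup>2)"

definition extremal_with_multiplier ::
  "real \<Rightarrow> real \<Rightarrow> real \<Rightarrow> real \<Rightarrow> real \<Rightarrow> real \<Rightarrow> (real \<Rightarrow> real) \<Rightarrow> real \<Rightarrow> bool" where
  "extremal_with_multiplier \<alpha> xbar x0 \<sigma>x \<sigma>S T f \<nu> \<longleftrightarrow>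
     equity_strategy T f \<and>
     (\<forall>\<eta>. continuous_on {0..T} \<eta> \<longrightarrow>
        ((\<lambda>\<epsilon>. mean_functional \<alpha> xbar x0 \<sigma>S T (\<lambda>s. f s + \<epsilon> * \<eta> s)
             + \<nu> * variance_functional \<alpha> \<sigma>x \<sigma>S T (\<lambda>s. f s + \<epsilon> * \<eta> s))
          has_real_derivative 0) (at 0))"

end

(* Writing L f for the integrand of the variance functional before squaring, the functional is
   quadratic in f and its first variation in the direction h is the integral of
   (xi - f + 2 nu L* (L f)) h, where the adjoint L* of L replaces the discounted integral over
   the future by a discounted integral over the past.  Hence the continuous bracket E vanishes
   on [0,T].  Both discounted integrals solve first-order linear ODEs, so E is twice
   differentiable, and E'' - alpha^2 E = 0 no longer contains them: this is the claimed ODE. *)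

theory Submission
  imports Defs
begin

section \<open>Discounted integrals over the future and the past, and their adjointness\<close>

definition discounted_future :: "real \<Rightarrow> real \<Rightarrow> (real \<Rightarrow> real) \<Rightarrow> real \<Rightarrow> real" where
  "discounted_future \<alpha> T f u = integral {u..T} (\<lambda>s. f s * exp (- \<alpha> * (s - u)))"

definition discounted_past :: "real \<Rightarrow> real \<Rightarrow> (real \<Rightarrow> real) \<Rightarrow> real \<Rightarrow> real" where
  "discounted_past \<alpha> a g s = integral {a..s} (\<lambda>u. g u * exp (- \<alpha> * (s - u)))"

text \<open>Splitting the kernel as \<open>exp (\<alpha> * u) * exp (- \<alpha> * s)\<close> leaves
  \<open>u\<close> only in a factor outside the integral and in the lower limit, so the product rule
  applies. Derivatives are taken within the interval, hence one-sided at its endpoints.\<close>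

lemma discounted_future_has_real_derivative:
  assumes "continuous_on {a..T} f" and "u \<in> {a..T}"
  shows "(discounted_future \<alpha> T f has_real_derivative \<alpha> * discounted_future \<alpha> T f u - f u)
           (at u within {a..T})"
proof -
  let ?h = "\<lambda>s. f s * exp (- \<alpha> * s)"
  have factor: "discounted_future \<alpha> T f = (\<lambda>u. exp (\<alpha> * u) * integral {u..T} ?h)"
  proof
    fix u
    have "(\<lambda>s. f s * exp (- \<alpha> * (s - u))) = (\<lambda>s. exp (\<alpha> * u) * ?h s)"
      by (rule ext) (simp add: algebra_simps flip: exp_add)
    then show "discounted_future \<alpha> T f u = exp (\<alpha> * u) * integral {u..T} ?h"
      by (simp add: discounted_future_def)
  qed
  have "continuous_on {a..T} ?h"
    by (intro continuous_intros assms)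
  note d = integral_has_real_derivative'[OF this assms(2)]
  \<comment> \<open>The boundary term from the lower limit is
    \<open>- f u * exp (- \<alpha> * u)\<close>; the outer factor turns it into
    \<open>- f u\<close>.\<close>
  have e: "exp (\<alpha> * u) * exp (- \<alpha> * u) = 1"
    by (simp flip: exp_add)
  show ?thesis
    unfolding factor
    by (rule derivative_eq_intros d refl)+ (use e in \<open>simp add: algebra_simps\<close>)
qed

text \<open>The same splitting, with the variable now in the upper limit: the boundary term is
  positive and the outer factor decays.\<close>

lemma discounted_past_has_real_derivative:
  assumes "continuous_on {a..T} g" and "s \<in> {a..T}"
  shows "(discounted_past \<alpha> a g has_real_derivative g s - \<alpha> * discounted_past \<alpha> a g s)
           (at s within {a..T})"
proof -
  let ?h = "\<lambda>u. g u * exp (\<alpha> * u)"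
  have factor: "discounted_past \<alpha> a g = (\<lambda>s. exp (- \<alpha> * s) * integral {a..s} ?h)"
  proof
    fix s
    have "(\<lambda>u. g u * exp (- \<alpha> * (s - u))) = (\<lambda>u. exp (- \<alpha> * s) * ?h u)"
      by (rule ext) (simp add: algebra_simps flip: exp_add)
    then show "discounted_past \<alpha> a g s = exp (- \<alpha> * s) * integral {a..s} ?h"
      by (simp add: discounted_past_def)
  qed
  have "continuous_on {a..T} ?h"
    by (intro continuous_intros assms)
  note d = integral_has_real_derivative[OF this assms(2)]
  have e: "exp (\<alpha> * s) * exp (- \<alpha> * s) = 1"
    by (simp flip: exp_add)
  show ?thesis
    unfolding factor
    by (rule derivative_eq_intros d refl)+ (use e in \<open>simp add: algebra_simps\<close>)
qed

lemma continuous_on_discounted_future: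
  "continuous_on {a..T} f \<Longrightarrow> continuous_on {a..T} (discounted_future \<alpha> T f)"
  by (rule DERIV_continuous_on) (rule discounted_future_has_real_derivative)

lemma continuous_on_discounted_past:
  "continuous_on {a..T} g \<Longrightarrow> continuous_on {a..T} (discounted_past \<alpha> a g)"
  by (rule DERIV_continuous_on) (rule discounted_past_has_real_derivative)

text \<open>Integrating the derivative of the product of the two discounted integrals avoids Fubini.\<close>

lemma integral_discounted_future_adjoint:
  assumes "a \<le> T" and g: "continuous_on {a..T} g" and h: "continuous_on {a..T} h"
  shows "integral {a..T} (\<lambda>u. g u * discounted_future \<alpha> T h u) =
         integral {a..T} (\<lambda>s. discounted_past \<alpha> a g s * h s)"
proof -
  let ?F = "discounted_future \<alpha> T h" and ?P = "discounted_past \<alpha> a g"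
  have "((\<lambda>u. ?P u * ?F u) has_real_derivative g u * ?F u - ?P u * h u) (at u within {a..T})"
    if "u \<in> {a..T}" for u
    by (rule derivative_eq_intros discounted_future_has_real_derivative[OF h that]
          discounted_past_has_real_derivative[OF g that] refl)+ (simp add: algebra_simps)
  then have "((\<lambda>u. g u * ?F u - ?P u * h u) has_integral ?P T * ?F T - ?P a * ?F a) {a..T}"
    using \<open>a \<le> T\<close>
    by (intro fundamental_theorem_of_calculus)
      (auto simp: has_real_derivative_iff_has_vector_derivative)
  \<comment> \<open>Both boundary terms vanish: \<open>?F T\<close> and \<open>?P a\<close> are
    integrals over a single point. The terms with \<alpha> have already cancelled in the product
    rule.\<close>
  then have "integral {a..T} (\<lambda>u. g u * ?F u - ?P u * h u) = 0"
    by (simp add: integral_unique discounted_future_def discounted_past_def)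
  moreover have "(\<lambda>u. g u * ?F u) integrable_on {a..T}" "(\<lambda>u. ?P u * h u) integrable_on {a..T}"
    by (intro integrable_continuous_real continuous_on_mult g h
          continuous_on_discounted_future continuous_on_discounted_past)+
  ultimately show ?thesis
    by (simp add: integral_diff)
qed

lemma discounted_future_add_mult:
  assumes "continuous_on {a..T} f" "continuous_on {a..T} h" "u \<in> {a..T}"
  shows "discounted_future \<alpha> T (\<lambda>s. f s + \<epsilon> * h s) u =
         discounted_future \<alpha> T f u + \<epsilon> * discounted_future \<alpha> T h u"
proof -
  \<comment> \<open>Since \<open>u\<close> lies in \<open>{a..T}\<close>, the range
    \<open>{u..T}\<close> stays inside the interval of continuity.\<close>
  have int: "(\<lambda>s. q s * exp (- \<alpha> * (s - u))) integrable_on {u..T}"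
    if "continuous_on {a..T} q" for q
    by (intro integrable_continuous_real continuous_intros continuous_on_subset[OF that])
      (use assms(3) in auto)
  have "(\<lambda>s. (f s + \<epsilon> * h s) * exp (- \<alpha> * (s - u))) =
        (\<lambda>s. f s * exp (- \<alpha> * (s - u)) + \<epsilon> * (h s * exp (- \<alpha> * (s - u))))"
    by (simp add: algebra_simps)
  then show ?thesis
    using integral_add[OF int[OF assms(1)] integrable_on_cmult_left[OF int[OF assms(2)], of \<epsilon>]]
    by (simp add: discounted_future_def)
qed

section \<open>Net exposure and its adjoint\<close>

text \<open>The variance functional with \<open>k = \<sigma>x / \<sigma>S\<close> is the squared \<open>L\<^sup>2\<close> norm of
  \<open>net_exposure \<alpha> k T f\<close>.\<close>

definition net_exposure :: "real \<Rightarrow> real \<Rightarrow> real \<Rightarrow> (real \<Rightarrow> real) \<Rightarrow> real \<Rightarrow> real" where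
  "net_exposure \<alpha> k T f u = f u - k * discounted_future \<alpha> T f u"

lemma continuous_on_net_exposure:
  "continuous_on {a..T} f \<Longrightarrow> continuous_on {a..T} (net_exposure \<alpha> k T f)"
  unfolding net_exposure_def by (intro continuous_intros continuous_on_discounted_future)

lemma net_exposure_add_mult:
  assumes "continuous_on {a..T} f" "continuous_on {a..T} h" "u \<in> {a..T}"
  shows "net_exposure \<alpha> k T (\<lambda>s. f s + \<epsilon> * h s) u =
         net_exposure \<alpha> k T f u + \<epsilon> * net_exposure \<alpha> k T h u"
  by (simp add: net_exposure_def discounted_future_add_mult[OF assms] algebra_simps)

text \<open>The identity part is self-adjoint and \<open>integral_discounted_future_adjoint\<close>
  moves the discounted part. This makes the direction \<open>h\<close> a bare factor of the
  integrand, the form to which the fundamental lemma applies.\<close>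

lemma integral_net_exposure_adjoint:
  assumes "a \<le> T" and g: "continuous_on {a..T} g" and h: "continuous_on {a..T} h"
  shows "integral {a..T} (\<lambda>u. g u * net_exposure \<alpha> k T h u) =
         integral {a..T} (\<lambda>u. (g u - k * discounted_past \<alpha> a g u) * h u)"
proof -
  note cont = g h continuous_on_discounted_future[OF h] continuous_on_discounted_past[OF g]
  have i: "(\<lambda>u. g u * h u) integrable_on {a..T}"
    "(\<lambda>u. k * (g u * discounted_future \<alpha> T h u)) integrable_on {a..T}"
    "(\<lambda>u. k * (discounted_past \<alpha> a g u * h u)) integrable_on {a..T}"
    by (intro integrable_continuous_real continuous_intros cont)+
  have "integral {a..T} (\<lambda>u. g u * net_exposure \<alpha> k T h u) =
        integral {a..T} (\<lambda>u. g u * h u - k * (g u * discounted_future \<alpha> T h u))"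
    by (simp add: net_exposure_def algebra_simps)
  also have "\<dots> = integral {a..T} (\<lambda>u. g u * h u - k * (discounted_past \<alpha> a g u * h u))"
    using integral_discounted_future_adjoint[OF assms]
    by (simp add: integral_diff[OF i(1) i(2)] integral_diff[OF i(1) i(3)])
  finally show ?thesis
    by (simp add: algebra_simps)
qed

section \<open>First variations of the mean and the variance\<close>

lemma integral_quadratic:
  fixes p q r :: "real \<Rightarrow> real"
  assumes "continuous_on {a..b} p" "continuous_on {a..b} q" "continuous_on {a..b} r"
  shows "integral {a..b} (\<lambda>s. p s + \<epsilon> * q s + \<epsilon>\<^sup>2 * r s) =
         integral {a..b} p + \<epsilon> * integral {a..b} q + \<epsilon>\<^sup>2 * integral {a..b} r"
proof -
  have "p integrable_on {a..b}" "q integrable_on {a..b}" "r integrable_on {a..b}"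
    using assms by (auto intro: integrable_continuous_real)
  then have "((\<lambda>s. p s + \<epsilon> * q s + \<epsilon>\<^sup>2 * r s) has_integral
      integral {a..b} p + \<epsilon> * integral {a..b} q + \<epsilon>\<^sup>2 * integral {a..b} r) {a..b}"
    by (intro has_integral_add has_integral_mult_right integrable_integral)
  then show ?thesis
    by (rule integral_unique)
qed

text \<open>The integral is an explicit polynomial in \<open>\<epsilon>\<close>, so its derivative
  at 0 is the linear coefficient; there is no differentiation under the integral sign.\<close>

lemma integral_quadratic_has_real_derivative:
  fixes p q r :: "real \<Rightarrow> real"
  assumes "continuous_on {a..b} p" "continuous_on {a..b} q" "continuous_on {a..b} r"
  shows "((\<lambda>\<epsilon>. integral {a..b} (\<lambda>s. p s + \<epsilon> * q s + \<epsilon>\<^sup>2 * r s)) has_real_derivative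
           integral {a..b} q) (at 0)"
  unfolding integral_quadratic[OF assms] by (rule derivative_eq_intros refl | simp)+

lemma continuous_on_xi: "continuous_on S (xi \<alpha> xbar x0 \<sigma>S)"
  unfolding xi_def by (intro continuous_intros)

lemma mean_functional_has_real_derivative:
  assumes f: "continuous_on {0..T} f" and h: "continuous_on {0..T} h"
  shows "((\<lambda>\<epsilon>. mean_functional \<alpha> xbar x0 \<sigma>S T (\<lambda>s. f s + \<epsilon> * h s)) has_real_derivative
           integral {0..T} (\<lambda>s. (xi \<alpha> xbar x0 \<sigma>S s - f s) * h s)) (at 0)"
proof -
  let ?X = "xi \<alpha> xbar x0 \<sigma>S"
  have "(\<lambda>\<epsilon>. mean_functional \<alpha> xbar x0 \<sigma>S T (\<lambda>s. f s + \<epsilon> * h s)) =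
    (\<lambda>\<epsilon>. integral {0..T} (\<lambda>s. (?X s * f s - (1 / 2) * (f s)\<^sup>2) + \<epsilon> * ((?X s - f s) * h s)
            + \<epsilon>\<^sup>2 * (- (1 / 2) * (h s)\<^sup>2)))"
    unfolding mean_functional_def
    by (intro ext integral_cong) (simp add: power2_eq_square algebra_simps)
  moreover have "((\<lambda>\<epsilon>. integral {0..T} (\<lambda>s. (?X s * f s - (1 / 2) * (f s)\<^sup>2)
      + \<epsilon> * ((?X s - f s) * h s) + \<epsilon>\<^sup>2 * (- (1 / 2) * (h s)\<^sup>2))) has_real_derivative
      integral {0..T} (\<lambda>s. (?X s - f s) * h s)) (at 0)"
    by (intro integral_quadratic_has_real_derivative continuous_intros continuous_on_xi f h)
  ultimately show ?thesis
    by simp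
qed

text \<open>By linearity of \<open>net_exposure\<close>, the linear coefficient in
  \<open>\<epsilon>\<close> is twice the integral of the product of the net exposures of
  \<open>f\<close> and \<open>h\<close>; the adjoint then frees \<open>h\<close>.\<close>

lemma variance_functional_has_real_derivative:
  assumes "0 \<le> T" and f: "continuous_on {0..T} f" and h: "continuous_on {0..T} h"
    and g: "g = net_exposure \<alpha> (\<sigma>x / \<sigma>S) T f"
  shows "((\<lambda>\<epsilon>. variance_functional \<alpha> \<sigma>x \<sigma>S T (\<lambda>s. f s + \<epsilon> * h s)) has_real_derivative
           2 * integral {0..T} (\<lambda>s. (g s - \<sigma>x / \<sigma>S * discounted_past \<alpha> 0 g s) * h s)) (at 0)"
proof -
  let ?L = "net_exposure \<alpha> (\<sigma>x / \<sigma>S) T"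
  note cont = continuous_on_net_exposure[OF f] continuous_on_net_exposure[OF h]
  have "variance_functional \<alpha> \<sigma>x \<sigma>S T (\<lambda>s. f s + \<epsilon> * h s) =
    integral {0..T} (\<lambda>s. (?L f s)\<^sup>2 + \<epsilon> * (2 * (?L f s * ?L h s)) + \<epsilon>\<^sup>2 * (?L h s)\<^sup>2)" for \<epsilon>
  proof -
    have "variance_functional \<alpha> \<sigma>x \<sigma>S T (\<lambda>s. f s + \<epsilon> * h s) =
          integral {0..T} (\<lambda>s. (?L (\<lambda>s. f s + \<epsilon> * h s) s)\<^sup>2)"
      by (simp add: variance_functional_def net_exposure_def discounted_future_def)
    also have "\<dots> = integral {0..T} (\<lambda>s. (?L f s)\<^sup>2 + \<epsilon> * (2 * (?L f s * ?L h s)) + \<epsilon>\<^sup>2 * (?L h s)\<^sup>2)"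
      \<comment> \<open>Linearity is available only at points of \<open>{0..T}\<close>, so the
        rewriting takes place under \<open>integral_cong\<close>.\<close>
      by (intro integral_cong, subst net_exposure_add_mult[OF f h])
        (simp_all add: power2_eq_square algebra_simps)
    finally show ?thesis .
  qed
  moreover have "((\<lambda>\<epsilon>. integral {0..T} (\<lambda>s. (?L f s)\<^sup>2 + \<epsilon> * (2 * (?L f s * ?L h s))
      + \<epsilon>\<^sup>2 * (?L h s)\<^sup>2)) has_real_derivative
      integral {0..T} (\<lambda>s. 2 * (?L f s * ?L h s))) (at 0)"
    by (intro integral_quadratic_has_real_derivative continuous_intros cont)
  ultimately show ?thesis
    using integral_net_exposure_adjoint[OF \<open>0 \<le> T\<close> cont(1) h] by (simp add: g)
qed

section \<open>The Euler-Lagrange equation\<close>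

text \<open>Every continuous direction is admissible, so \<open>E\<close> can be tested against
  itself; a continuous nonnegative function with zero integral, here the square of \<open>E\<close>,
  vanishes.\<close>

lemma fundamental_lemma_calculus_of_variations:
  fixes E :: "real \<Rightarrow> real"
  assumes "a < b" and E: "continuous_on {a..b} E"
    and "\<And>h. continuous_on {a..b} h \<Longrightarrow> integral {a..b} (\<lambda>s. E s * h s) = 0"
    and "s \<in> {a..b}"
  shows "E s = 0"
proof -
  have "continuous_on {a..b} (\<lambda>s. E s * E s)"
    by (intro continuous_on_mult E)
  from integral_eq_0_iff[OF this \<open>a < b\<close>] assms(3)[OF E] \<open>s \<in> {a..b}\<close> show ?thesis
    by simp
qed

lemma extremal_euler_lagrange:
  assumes "T > 0" and ext: "extremal_with_multiplier \<alpha> xbar x0 \<sigma>x \<sigma>S T f \<nu>"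
    and g: "g = net_exposure \<alpha> (\<sigma>x / \<sigma>S) T f" and "s \<in> {0..T}"
  shows "xi \<alpha> xbar x0 \<sigma>S s - f s + 2 * \<nu> * (g s - \<sigma>x / \<sigma>S * discounted_past \<alpha> 0 g s) = 0"
proof (rule fundamental_lemma_calculus_of_variations[OF \<open>T > 0\<close> _ _ \<open>s \<in> {0..T}\<close>])
  let ?k = "\<sigma>x / \<sigma>S"
  let ?E1 = "\<lambda>s. xi \<alpha> xbar x0 \<sigma>S s - f s" and ?E2 = "\<lambda>s. g s - ?k * discounted_past \<alpha> 0 g s"
  have f: "continuous_on {0..T} f"
    using ext by (simp add: extremal_with_multiplier_def equity_strategy_def)
  then have "continuous_on {0..T} g"
    unfolding g by (rule continuous_on_net_exposure)
  then have cont: "continuous_on {0..T} ?E1" "continuous_on {0..T} ?E2"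
    by (intro continuous_intros continuous_on_xi continuous_on_discounted_past f)+
  then show "continuous_on {0..T} (\<lambda>s. ?E1 s + 2 * \<nu> * ?E2 s)"
    by (intro continuous_on_add continuous_on_mult continuous_on_const)
  fix h :: "real \<Rightarrow> real" assume h: "continuous_on {0..T} h"
  have "((\<lambda>\<epsilon>. mean_functional \<alpha> xbar x0 \<sigma>S T (\<lambda>s. f s + \<epsilon> * h s)
           + \<nu> * variance_functional \<alpha> \<sigma>x \<sigma>S T (\<lambda>s. f s + \<epsilon> * h s)) has_real_derivative
         integral {0..T} (\<lambda>s. ?E1 s * h s) + \<nu> * (2 * integral {0..T} (\<lambda>s. ?E2 s * h s))) (at 0)"
    using \<open>T > 0\<close>
    by (intro DERIV_add DERIV_cmult mean_functional_has_real_derivative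
          variance_functional_has_real_derivative f h g) simp
  moreover have "((\<lambda>\<epsilon>. mean_functional \<alpha> xbar x0 \<sigma>S T (\<lambda>s. f s + \<epsilon> * h s)
           + \<nu> * variance_functional \<alpha> \<sigma>x \<sigma>S T (\<lambda>s. f s + \<epsilon> * h s)) has_real_derivative 0) (at 0)"
    using ext h by (simp add: extremal_with_multiplier_def)
  \<comment> \<open>The computed first variation and the value 0 required by stationarity are
    derivatives of the same function of \<open>\<epsilon>\<close> at 0.\<close>
  ultimately have
    "integral {0..T} (\<lambda>s. ?E1 s * h s) + \<nu> * (2 * integral {0..T} (\<lambda>s. ?E2 s * h s)) = 0"
    by (rule DERIV_unique)
  moreover have "integral {0..T} (\<lambda>s. ?E1 s * h s + 2 * \<nu> * (?E2 s * h s)) =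
    integral {0..T} (\<lambda>s. ?E1 s * h s) + integral {0..T} (\<lambda>s. 2 * \<nu> * (?E2 s * h s))"
    by (intro integral_add integrable_continuous_real continuous_on_mult continuous_on_const cont h)
  moreover have "(\<lambda>s. (?E1 s + 2 * \<nu> * ?E2 s) * h s) = (\<lambda>s. ?E1 s * h s + 2 * \<nu> * (?E2 s * h s))"
    by (simp add: algebra_simps)
  ultimately show "integral {0..T} (\<lambda>s. (?E1 s + 2 * \<nu> * ?E2 s) * h s) = 0"
    by simp
qed

section \<open>From the Euler-Lagrange equation to the differential equation\<close>

text \<open>Each point of a nondegenerate interval, endpoints included, is a limit point of it, so
  derivatives within the interval are unique. Identities valid on the interval may thus be
  differentiated up to its ends.\<close>

lemma has_real_derivative_eq_zero_if_zero_on: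
  fixes F :: "real \<Rightarrow> real"
  assumes "a < b" "s \<in> {a..b}" and F: "(F has_real_derivative D) (at s within {a..b})"
    and "\<And>t. t \<in> {a..b} \<Longrightarrow> F t = 0"
  shows "D = 0"
proof -
  have "((\<lambda>_. 0) has_real_derivative D) (at s within {a..b})"
    by (rule has_field_derivative_transform_within[OF F zero_less_one \<open>s \<in> {a..b}\<close>]) (rule assms(4))
  moreover have "((\<lambda>_. 0) has_real_derivative 0) (at s within {a..b})"
    by (rule DERIV_const)
  moreover have "at s within {a..b} \<noteq> bot"
    using islimpt_Icc[OF \<open>a < b\<close>, of s] \<open>s \<in> {a..b}\<close> by (simp add: trivial_limit_within)
  ultimately show ?thesis
    by (rule has_field_derivative_unique)
qed

theorem lemma3p4:
  fixes \<alpha> xbar x0 \<sigma>x \<sigma>S T \<nu> :: real and f f' f'' :: "real \<Rightarrow> real"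
  assumes "\<sigma>x > 0" and "\<sigma>S > 0" and "T > 0"
    and "extremal_with_multiplier \<alpha> xbar x0 \<sigma>x \<sigma>S T f \<nu>"
    and "\<And>s. s \<in> {0..T} \<Longrightarrow> (f has_real_derivative f' s) (at s within {0..T})"
    and "\<And>s. s \<in> {0..T} \<Longrightarrow> (f' has_real_derivative f'' s) (at s within {0..T})"
  shows "\<forall>s\<in>{0..T}.
    (let A = 1 - 2 * \<nu>;
         C = 2 * \<nu> * (\<alpha> - \<sigma>x / \<sigma>S)\<^sup>2 - \<alpha>\<^sup>2;
         D = \<alpha>\<^sup>2 * (xbar / \<sigma>S)
     in A * f'' s + C * f s + D = 0)"
proof
  fix s assume s: "s \<in> {0..T}"
  define k where "k = \<sigma>x / \<sigma>S"
  define g where "g = net_exposure \<alpha> k T f"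
  define p where "p = discounted_past \<alpha> 0 g"
  \<comment> \<open>With this \<open>c\<close>, the function \<open>xi\<close> is a constant plus
    \<open>c * exp (- \<alpha> * t)\<close>. Subtracting \<alpha> squared times the function from
    its second derivative kills the exponential; the constant produces \<open>D\<close>.\<close>
  define c where "c = (x0 - xbar) / \<sigma>S"
  let ?I = "{0..T}" and ?X = "xi \<alpha> xbar x0 \<sigma>S"
  have X: "?X t = xbar / \<sigma>S + c * exp (- \<alpha> * t)" for t
    by (simp add: xi_def c_def add_divide_distrib)
  have f: "continuous_on ?I f"
    using assms(5) by (rule DERIV_continuous_on)
  have g: "continuous_on ?I g"
    unfolding g_def by (rule continuous_on_net_exposure[OF f])
  \<comment> \<open>Differentiating \<open>g\<close> brings back the discounted future integral;
    replacing \<open>k\<close> times that integral by \<open>f t - g t\<close> closes the equation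
    in \<open>g\<close> and \<open>f\<close>, so it can be differentiated again.\<close>
  define g' where "g' t = \<alpha> * g t + f' t + (k - \<alpha>) * f t" for t
  have dg: "(g has_real_derivative g' t) (at t within ?I)" if "t \<in> ?I" for t
    unfolding g_def net_exposure_def[abs_def]
    by (rule derivative_eq_intros assms(5)[OF that] refl
          discounted_future_has_real_derivative[OF f that])+
      (simp add: g'_def g_def net_exposure_def algebra_simps)
  have dg': "(g' has_real_derivative \<alpha> * g' t + f'' t + (k - \<alpha>) * f' t) (at t within ?I)"
    if "t \<in> ?I" for t
    unfolding g'_def[abs_def]
    by (rule derivative_eq_intros assms(5)[OF that] assms(6)[OF that] dg[OF that] refl)+
      (simp add: g'_def)
  have dp: "(p has_real_derivative g t - \<alpha> * p t) (at t within ?I)" if "t \<in> ?I" for t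
    unfolding p_def by (rule discounted_past_has_real_derivative[OF g that])

  have E0: "?X t - f t + 2 * \<nu> * (g t - k * p t) = 0" if "t \<in> ?I" for t
    using extremal_euler_lagrange[OF assms(3,4) _ that] by (simp add: g_def k_def p_def)
  have E1: "- \<alpha> * c * exp (- \<alpha> * t) - f' t + 2 * \<nu> * (g' t - k * (g t - \<alpha> * p t)) = 0"
    if t: "t \<in> ?I" for t
  proof (rule has_real_derivative_eq_zero_if_zero_on[OF \<open>T > 0\<close> t _ E0])
    show "((\<lambda>t. ?X t - f t + 2 * \<nu> * (g t - k * p t)) has_real_derivative
        - \<alpha> * c * exp (- \<alpha> * t) - f' t + 2 * \<nu> * (g' t - k * (g t - \<alpha> * p t))) (at t within ?I)"
      unfolding X by (rule derivative_eq_intros assms(5)[OF t] dg[OF t] dp[OF t] refl)+ simp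
  qed
  have E2: "\<alpha>\<^sup>2 * c * exp (- \<alpha> * s) - f'' s
      + 2 * \<nu> * (\<alpha> * g' s + f'' s + (k - \<alpha>) * f' s - k * (g' s - \<alpha> * (g s - \<alpha> * p s))) = 0"
  proof (rule has_real_derivative_eq_zero_if_zero_on[OF \<open>T > 0\<close> s _ E1])
    show "((\<lambda>t. - \<alpha> * c * exp (- \<alpha> * t) - f' t + 2 * \<nu> * (g' t - k * (g t - \<alpha> * p t)))
        has_real_derivative \<alpha>\<^sup>2 * c * exp (- \<alpha> * s) - f'' s
      + 2 * \<nu> * (\<alpha> * g' s + f'' s + (k - \<alpha>) * f' s - k * (g' s - \<alpha> * (g s - \<alpha> * p s))))
      (at s within ?I)"
      by (rule derivative_eq_intros assms(6)[OF s] dg[OF s] dg'[OF s] dp[OF s] refl)+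
        (simp add: power2_eq_square)
  qed
  \<comment> \<open>The right side is \<alpha> squared times the left side of \<open>E0\<close>,
    minus that of \<open>E2\<close>. The exponential and \<open>p\<close> cancel directly. Inserting
    the formula for \<open>g'\<close> into the remaining \<open>(k - \<alpha>) * g' s\<close>
    cancels \<open>g\<close> and \<open>f'\<close> and leaves the square of
    \<open>k - \<alpha>\<close> times \<open>f s\<close>.\<close>
  have "(1 - 2 * \<nu>) * f'' s + (2 * \<nu> * (\<alpha> - k)\<^sup>2 - \<alpha>\<^sup>2) * f s + \<alpha>\<^sup>2 * (xbar / \<sigma>S) =
    \<alpha>\<^sup>2 * (?X s - f s + 2 * \<nu> * (g s - k * p s)) - (\<alpha>\<^sup>2 * c * exp (- \<alpha> * s) - f'' s
      + 2 * \<nu> * (\<alpha> * g' s + f'' s + (k - \<alpha>) * f' s - k * (g' s - \<alpha> * (g s - \<alpha> * p s))))"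
    by (simp add: X g'_def power2_eq_square algebra_simps)
  also have "\<dots> = 0"
    by (simp only: E0[OF s] E2 mult_zero_right diff_zero)
  finally have "(1 - 2 * \<nu>) * f'' s + (2 * \<nu> * (\<alpha> - k)\<^sup>2 - \<alpha>\<^sup>2) * f s + \<alpha>\<^sup>2 * (xbar / \<sigma>S) = 0" .
  then show "let A = 1 - 2 * \<nu>;
         C = 2 * \<nu> * (\<alpha> - \<sigma>x / \<sigma>S)\<^sup>2 - \<alpha>\<^sup>2;
         D = \<alpha>\<^sup>2 * (xbar / \<sigma>S)
     in A * f'' s + C * f s + D = 0"
    by (simp add: k_def)
qed

end
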